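(* Let $k\in\mathbb{N}_0$ and $a\in\mathbb{C}\setminus\{0,-1,-2,\ldots\}$, and let $z,s\in\mathbb{C}$. Consider the series $$H_k(z,s,a)=\sum_{r=0}^{\infty}\frac{A(r+1,k)\,z^r}{(r+a)^s}.$$ (i) If $|z|<1$, the series converges absolutely for every $s\in\mathbb{C}$. (ii) If $z=1$, the series converges if and only if $\operatorname{Re}(s)>3$, and in that case the convergence is absolute. (iii) If $|z|=1$ and $z\neq1$, the series converges if and only if $\operatorname{Re}(s)>2$; in this case the convergence is absolute for $\operatorname{Re}(s)>3$ and conditional (convergent but not absolutely convergent) for $2<\operatorname{Re}(s)\le 3$.
   Context: $\mathbb{N}_0=\{0,1,2,\ldots\}$. The $k$-augmented centered triangular numbers are given by $A(r+1,k)=\alpha_k r^2+\beta_k r+1$ for integers $r\ge0$, where $\alpha_k=\frac32 4^k$ and $\beta_k=\frac32 2^k$. Complex powers are principal: $(r+a)^{-s}=\exp\{-s\operatorname{Log}(r+a)\}$ with $\operatorname{Log}w=\log|w|+i\operatorname{Arg}w$, $-\pi<\operatorname{Arg}w\le\pi$. *)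

theory Defs
  imports "HOL-Analysis.Analysis"
begin

definition aug_alpha :: "nat \<Rightarrow> real" where
  "aug_alpha k = 3 / 2 * 4 ^ k"

definition aug_beta :: "nat \<Rightarrow> real" where
  "aug_beta k = 3 / 2 * 2 ^ k"

text \<open>
  The sequence of k-augmented centered triangular numbers is indexed from 1; the value at index 0
  has no meaning. The subtraction is the real one.
\<close>
definition aug_tri :: "nat \<Rightarrow> nat \<Rightarrow> real" where
  "aug_tri n k = aug_alpha k * (real n - 1)\<^sup>2 + aug_beta k * (real n - 1) + 1"

lemma aug_tri_add_one: "aug_tri (r + 1) k = aug_alpha k * (real r)\<^sup>2 + aug_beta k * real r + 1"
  by (simp add: aug_tri_def)

text \<open>
  The complex \<open>powr\<close> uses the principal logarithm with imaginary part in \<open>(-\<pi>, \<pi>]\<close>.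
  Its convention \<open>0 powr s = 0\<close> matters only when \<open>a\<close> is a nonpositive integer.
  The power \<open>z ^ r\<close> gives \<open>1\<close> at \<open>r = 0\<close>, also for \<open>z = 0\<close>.
\<close>
definition H_term :: "nat \<Rightarrow> complex \<Rightarrow> complex \<Rightarrow> complex \<Rightarrow> nat \<Rightarrow> complex" where
  "H_term k z s a r = of_real (aug_tri (r + 1) k) * z ^ r / (of_nat r + a) powr s"

definition converges_absolutely :: "(nat \<Rightarrow> complex) \<Rightarrow> bool" where
  "converges_absolutely f \<longleftrightarrow> summable (\<lambda>n. norm (f n))"

definition converges_conditionally :: "(nat \<Rightarrow> complex) \<Rightarrow> bool" where
  "converges_conditionally f \<longleftrightarrow> summable f \<and> \<not> converges_absolutely f"

end

theory Submission
  imports Defs "HOL-Real_Asymp.Real_Asymp"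
begin

text \<open>
  For \<open>z = 1\<close> the terms \<open>f r\<close> of the series behave like \<open>\<alpha> r\<^sup>2 / r\<^sup>s\<close>, and their differences
  are smaller by a factor \<open>r\<close>: with \<open>p = 2 - Re s\<close>,
  \<open>|f r| \<in> \<Theta>(r\<^sup>p)\<close> and \<open>|f (r + 1) - f r| \<in> O(r\<^bsup>p - 1\<^esup>)\<close>
  (\<open>norm_H_term_one_bigtheta\<close> and \<open>norm_H_term_one_diff_bigo\<close>). These two estimates decide the
  behaviour of the power series \<open>\<Sum> f r z\<^sup>r\<close> in the whole closed unit disc.

  Absolute convergence is read off from the size of the terms alone. On the unit circle the terms
  \<open>f r z\<^sup>r\<close> tend to zero only if \<open>p < 0\<close>; conversely, for \<open>p < 0\<close> and \<open>z \<noteq> 1\<close> summation by parts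
  against \<open>z\<^sup>r\<close> turns the series into the absolutely convergent
  \<open>\<Sum> (f (r + 1) - f r) z\<^bsup>r + 1\<^esup>\<close> (\<open>summable_times_power_unit_circle\<close>).

  The remaining point is divergence at \<open>z = 1\<close> when \<open>-1 \<le> p < 0\<close>. The terms may rotate, as for
  \<open>r\<^bsup>-1-it\<^esup>\<close>, but they do so slowly: for a small fixed \<open>\<delta>\<close> and large \<open>n\<close>, all terms with
  index in \<open>[n, (1 + \<delta>) n]\<close> are within half of \<open>|f n|\<close> from \<open>f n\<close>. Such a block therefore has a sum
  of order \<open>n\<^bsup>p + 1\<^esup>\<close>, which does not tend to zero
  (\<open>summable_imp_exponent_less_minus_one\<close>).

  Both estimates on \<open>f\<close> come from one observation: \<open>f r\<close> and \<open>f (r + 1)\<close> are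
  \<open>r\<^bsup>2 - s\<^esup>\<close> times functions of \<open>1/r\<close> that are analytic at \<open>0\<close> and share the value \<open>\<alpha>\<close> there.
\<close>

section \<open>Series whose terms vary slowly\<close>

lemma tendsto_0_imp_exponent_neg:
  fixes f :: "nat \<Rightarrow> complex"
  assumes "(\<lambda>r. norm (f r)) \<in> \<Omega>(\<lambda>r. real r powr p)" and "f \<longlonglongrightarrow> 0"
  shows "p < 0"
proof (rule ccontr)
  assume "\<not> p < 0"
  hence "(\<lambda>r. 1 :: real) \<in> O(\<lambda>r. real r powr p)"
    by (intro landau_o.bigI[where c = 1] eventually_mono[OF eventually_ge_at_top[of 1]])
       (auto intro!: ge_one_powr_ge_zero)
  also have "(\<lambda>r. real r powr p) \<in> O(\<lambda>r. norm (f r))"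
    using assms(1) by (simp add: bigomega_iff_bigo)
  also have "(\<lambda>r. norm (f r)) \<in> o(\<lambda>r. 1)"
    using assms(2) by (intro smalloI_tendsto) (auto intro!: tendsto_norm_zero)
  finally show False
    by (simp add: landau_o.small_refl_iff)
qed

text \<open>
  A geometric factor beats every power of \<open>r\<close>. The ratio is first raised to a value strictly
  between \<open>0\<close> and \<open>1\<close>, so that \<open>z = 0\<close> needs no separate treatment.
\<close>
lemma summable_norm_times_power:
  fixes f :: "nat \<Rightarrow> complex"
  assumes f: "(\<lambda>r. norm (f r)) \<in> O(\<lambda>r. real r powr p)" and z: "norm z < 1"
  shows "summable (\<lambda>r. norm (f r * z ^ r))"
proof (rule summable_comparison_test_bigo)
  show "summable (\<lambda>r. norm (real r powr (-2)))"
    by (simp add: summable_real_powr_iff)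
  define t where "t = (norm z + 1) / 2"
  have t: "0 < t" "t < 1" "norm z \<le> t" using z by (auto simp: t_def add_nonneg_pos)
  have "(\<lambda>r. norm z ^ r) \<in> O(\<lambda>r. t ^ r)"
    using t by (intro landau_o.bigI[where c = 1] always_eventually) (auto intro!: power_mono)
  with f have "(\<lambda>r. norm (f r) * norm z ^ r) \<in> O(\<lambda>r. real r powr p * t ^ r)"
    by (rule landau_o.big.mult)
  also have "(\<lambda>r. real r powr p * t ^ r) \<in> O(\<lambda>r. real r powr (-2))"
    using t(1,2) by real_asymp
  finally show "(\<lambda>r. norm (f r * z ^ r)) \<in> O(\<lambda>r. real r powr (-2))"
    by (simp add: norm_mult norm_power)
qed

lemma summable_norm_iff_exponent:
  fixes f :: "nat \<Rightarrow> complex"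
  assumes "(\<lambda>r. norm (f r)) \<in> \<Theta>(\<lambda>r. real r powr p)"
  shows "summable (\<lambda>r. norm (f r)) \<longleftrightarrow> p < -1"
proof
  assume "p < -1"
  hence "summable (\<lambda>r. norm (real r powr p))" by (simp add: summable_real_powr_iff)
  thus "summable (\<lambda>r. norm (f r))"
    by (rule summable_comparison_test_bigo) (use assms in blast)
next
  assume "summable (\<lambda>r. norm (f r))"
  hence "summable (\<lambda>r. norm (norm (f r)))" by simp
  hence "summable (\<lambda>r. real r powr p)"
    by (rule summable_comparison_test_bigo) (use assms in \<open>simp add: bigtheta_sym bigthetaD1\<close>)
  thus "p < -1" by (simp add: summable_real_powr_iff)
qed

text \<open>
  Summation by parts against the bounded partial sums of \<open>z\<^sup>r\<close>. It takes the form of the identity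
  \<open>(z - 1) f r z\<^sup>r = (f (r + 1) z\<^bsup>r + 1\<^esup> - f r z\<^sup>r) - (f (r + 1) - f r) z\<^bsup>r + 1\<^esup>\<close>,
  whose first part telescopes and whose second part is absolutely summable since \<open>p - 1 < -1\<close>.
\<close>
lemma summable_times_power_unit_circle:
  fixes f :: "nat \<Rightarrow> complex"
  assumes f: "(\<lambda>r. norm (f r)) \<in> O(\<lambda>r. real r powr p)"
    and df: "(\<lambda>r. norm (f (Suc r) - f r)) \<in> O(\<lambda>r. real r powr (p - 1))"
    and z: "norm z = 1" "z \<noteq> 1" and p: "p < 0"
  shows "summable (\<lambda>r. f r * z ^ r)"
proof -
  note f
  also have "(\<lambda>r. real r powr p) \<in> o(\<lambda>r. 1)" using p by real_asymp
  finally have "(\<lambda>r. norm (f r)) \<longlonglongrightarrow> 0" by (auto dest: smalloD_tendsto)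
  hence "(\<lambda>r. f r * z ^ r) \<longlonglongrightarrow> 0"
    by (subst tendsto_norm_zero_iff [symmetric]) (simp add: norm_mult norm_power z)
  hence 1: "summable (\<lambda>r. f (Suc r) * z ^ Suc r - f r * z ^ r)"
    by (rule telescope_summable)
  have "summable (\<lambda>r. norm (real r powr (p - 1)))" using p by (simp add: summable_real_powr_iff)
  from summable_comparison_test_bigo[OF this df]
  have "summable (\<lambda>r. norm ((f (Suc r) - f r) * z ^ Suc r))"
    by (simp only: norm_mult norm_power z power_one mult_1_right)
  hence 2: "summable (\<lambda>r. (f (Suc r) - f r) * z ^ Suc r)"
    by (rule summable_norm_cancel)
  have "summable (\<lambda>r. ((f (Suc r) * z ^ Suc r - f r * z ^ r) - (f (Suc r) - f r) * z ^ Suc r) / (z - 1))"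
    by (intro summable_divide summable_diff 1 2)
  also have "(\<lambda>r. ((f (Suc r) * z ^ Suc r - f r * z ^ r) - (f (Suc r) - f r) * z ^ Suc r) / (z - 1))
             = (\<lambda>r. f r * z ^ r)"
    using z(2) by (simp add: fun_eq_iff field_simps)
  finally show ?thesis .
qed

text \<open>
  The terms need not have constant sign or direction, so comparison with \<open>\<Sum> r\<^sup>p\<close> is not available.
  Suppose \<open>-1 \<le> p\<close>; then \<open>p < 0\<close>, as the terms tend to zero. For large \<open>r\<close> let \<open>|f r| \<ge> c r\<^sup>p\<close> and
  \<open>|f (r + 1) - f r| \<le> C r\<^bsup>p - 1\<^esup>\<close>, with \<open>c, C > 0\<close>. The Cauchy criterion is violated on
  blocks \<open>n, \<dots>, n + m - 1\<close> with \<open>n = M m\<close> and \<open>M\<close> fixed.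
  Along such a block \<open>f\<close> changes by at most \<open>m C n\<^bsup>p - 1\<^esup> = (C / M) n\<^sup>p\<close>. If \<open>M\<close> is large,
  this is at most \<open>|f n| / 2\<close>, so the block sum is at least
  \<open>m |f n| / 2 \<ge> c / (2 M) n\<^bsup>p + 1\<^esup> \<ge> c / (2 M)\<close>.
\<close>
lemma summable_imp_exponent_less_minus_one:
  fixes f :: "nat \<Rightarrow> complex"
  assumes f: "(\<lambda>r. norm (f r)) \<in> \<Omega>(\<lambda>r. real r powr p)"
    and df: "(\<lambda>r. norm (f (Suc r) - f r)) \<in> O(\<lambda>r. real r powr (p - 1))"
    and sum: "summable f"
  shows "p < -1"
proof (rule ccontr)
  assume "\<not> p < -1"
  hence p: "-1 \<le> p" "p < 0"
    using tendsto_0_imp_exponent_neg[OF f] summable_LIMSEQ_zero[OF sum] by auto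
  obtain c where c: "c > 0" "\<forall>\<^sub>F r in sequentially. c * real r powr p \<le> norm (f r)"
    using landau_omega.bigE[OF f] by (auto simp: abs_of_nonneg)
  obtain C where C: "C > 0"
    "\<forall>\<^sub>F r in sequentially. norm (f (Suc r) - f r) \<le> C * real r powr (p - 1)"
    using landau_o.bigE[OF df] by (auto simp: abs_of_nonneg)
  obtain R where R: "\<And>r. r \<ge> R \<Longrightarrow> c * real r powr p \<le> norm (f r)"
      "\<And>r. r \<ge> R \<Longrightarrow> norm (f (Suc r) - f r) \<le> C * real r powr (p - 1)"
    using eventually_conj[OF c(2) C(2)] by (auto simp: eventually_at_top_linorder)
  define M where "M = nat \<lceil>2 * C / c\<rceil> + 1"
  have M: "M > 0" "C / M \<le> c / 2"
  proof -
    show "M > 0" by (simp add: M_def)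
    have "2 * C / c \<le> M" unfolding M_def by linarith
    thus "C / M \<le> c / 2" using c(1) \<open>M > 0\<close> by (simp add: field_simps)
  qed
  define e where "e = c / (2 * M)"
  have e: "e > 0" using c M by (simp add: e_def)
  obtain N where N: "\<And>m n. m \<ge> N \<Longrightarrow> norm (sum f {m..<n}) < e"
    using sum e unfolding summable_Cauchy by blast
  define m where "m = max (max R N) 1"
  define n where "n = M * m"
  have n: "n \<ge> R" "n \<ge> N" "n \<ge> 1" "m \<ge> 1"
  proof -
    have "m \<le> n" using M(1) by (simp add: n_def)
    moreover have "m \<ge> R" "m \<ge> N" "m \<ge> 1" by (auto simp: m_def)
    ultimately show "n \<ge> R" "n \<ge> N" "n \<ge> 1" "m \<ge> 1" by linarith+
  qed
  have close: "norm (f (n + j) - f n) \<le> real j * (C * real n powr (p - 1))" for j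
  proof (induction j)
    case (Suc j)
    have "norm (f (n + Suc j) - f n) \<le> norm (f (Suc (n + j)) - f (n + j)) + norm (f (n + j) - f n)"
      by (rule order_trans[OF _ norm_triangle_ineq]) simp
    also have "norm (f (Suc (n + j)) - f (n + j)) \<le> C * real (n + j) powr (p - 1)"
      using n by (intro R(2)) auto
    also have "\<dots> \<le> C * real n powr (p - 1)"
      using n p C(1) by (intro mult_left_mono powr_mono2') auto
    finally show ?case using Suc by (simp add: algebra_simps)
  qed auto
  have close': "norm (f (n + j) - f n) \<le> norm (f n) / 2" if "j < m" for j
  proof -
    have "norm (f (n + j) - f n) \<le> real j * (C * real n powr (p - 1))" by (rule close)
    also have "\<dots> \<le> real m * (C * real n powr (p - 1))"
      using that C by (intro mult_right_mono) auto
    also have "\<dots> = C / M * real n powr p"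
      using n M(1) by (simp add: n_def powr_diff)
    also have "\<dots> \<le> c / 2 * real n powr p"
      by (intro mult_right_mono M) auto
    also have "\<dots> \<le> norm (f n) / 2" using R(1)[of n] n by simp
    finally show ?thesis .
  qed
  have "e = c / (2 * M) * 1" by (simp add: e_def)
  also have "\<dots> \<le> c / (2 * M) * real n powr (p + 1)"
    using n p c by (intro mult_left_mono ge_one_powr_ge_zero) auto
  also have "\<dots> = m * (c * real n powr p / 2)"
    using n M(1) by (simp add: n_def powr_add)
  also have "\<dots> \<le> m * (norm (f n) / 2)"
    using R(1)[of n] n by (intro mult_left_mono) auto
  also have "\<dots> = norm (\<Sum>j<m. f n) - (\<Sum>j<m. norm (f n) / 2)"
    by (simp add: norm_mult)
  also have "\<dots> \<le> norm (\<Sum>j<m. f n) - norm (\<Sum>j<m. f (n + j) - f n)"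
    by (intro diff_left_mono sum_norm_le close') auto
  also have "\<dots> \<le> norm (\<Sum>j<m. f (n + j))"
    using norm_diff_ineq[of "\<Sum>j<m. f n" "\<Sum>j<m. f (n + j) - f n"] 
    by (simp add: sum_subtractf)
  also have "(\<Sum>j<m. f (n + j)) = sum f {n..<n + m}"
    by (rule sum.reindex_bij_witness[of _ "\<lambda>i. i - n" "\<lambda>j. n + j"]) auto
  also have "norm \<dots> < e" using N n by blast
  finally show False by simp
qed

section \<open>Size and variation of the terms at \<open>z = 1\<close>\<close>

text \<open>
  For principal powers \<open>(u v)\<^sup>s = u\<^sup>s v\<^sup>s\<close> may fail; here it holds since the factor taken out is a
  positive real number and does not change the argument.
\<close>
lemma powr_of_nat_plus:
  assumes "r > 0" "of_nat r + b \<noteq> 0"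
  shows "(of_nat r + b) powr s = of_nat r powr s * (1 + b / of_nat r) powr (s :: complex)"
proof -
  have "of_nat r + b = of_nat r * (1 + b / of_nat r)" using assms by (simp add: field_simps)
  moreover have nz: "1 + b / of_nat r \<noteq> 0" using assms by (simp add: field_simps)
  ultimately have "Ln (of_nat r + b) = Ln (of_nat r) + Ln (1 + b / of_nat r)"
    using Ln_times_of_nat[OF assms(1) nz] by simp
  thus ?thesis
    using assms nz by (simp add: powr_def exp_add ring_distribs)
qed

text \<open>
  This is the function of \<open>x = 1 / r\<close> that remains of \<open>(u r\<^sup>2 + v r + w) / (r + b)\<^sup>s\<close> after the factor
  \<open>r\<^bsup>2 - s\<^esup>\<close> is taken out. It is analytic at \<open>x = 0\<close>, which encodes the asymptotic expansion of
  the quotient in powers of \<open>1 / r\<close>.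
\<close>
definition H_germ :: "complex \<Rightarrow> complex \<Rightarrow> complex \<Rightarrow> complex \<Rightarrow> complex \<Rightarrow> complex \<Rightarrow> complex" where
  "H_germ u v w b s x = (u + v * x + w * x\<^sup>2) / (1 + b * x) powr s"

lemma H_germ_0 [simp]: "H_germ u v w b s 0 = u"
  by (simp add: H_germ_def)

lemma analytic_H_germ: "H_germ u v w b s analytic_on {0}"
  unfolding H_germ_def by (intro analytic_intros) auto

lemma H_germ_expands:
  assumes "r > 0" "of_nat r + b \<noteq> 0"
  shows "(u * of_nat r ^ 2 + v * of_nat r + w) / (of_nat r + b) powr s =
         of_nat r powr (2 - s) * H_germ u v w b s (1 / of_nat r)"
proof -
  have "u * of_nat r ^ 2 + v * of_nat r + w
      = of_nat r ^ 2 * (u + v * (1 / of_nat r) + w * (1 / of_nat r)\<^sup>2)"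
    using assms by (simp add: field_simps power2_eq_square)
  thus ?thesis using assms
    by (simp add: H_germ_def powr_of_nat_plus powr_diff mult_ac)
qed

lemma analytic_bigo_at_inverse_nat:
  fixes g :: "complex \<Rightarrow> complex"
  assumes "g analytic_on {0}" "g 0 = 0"
  shows "(\<lambda>r. g (1 / of_nat r)) \<in> O(\<lambda>r. 1 / of_nat r)"
proof -
  obtain D where D: "(g has_field_derivative D) (at 0)"
    using assms(1) analytic_on_imp_differentiable_at field_differentiable_def by blast
  hence "((\<lambda>x. g x / x) \<longlongrightarrow> D) (at 0)" using assms(2) by (simp add: has_field_derivative_iff)
  moreover have "filterlim (\<lambda>r. 1 / of_nat r :: complex) (at 0) sequentially"
    unfolding filterlim_at
    by (auto intro!: lim_1_over_n eventually_mono[OF eventually_gt_at_top[of 0]])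
  ultimately have "((\<lambda>r. g (1 / of_nat r) / (1 / of_nat r)) \<longlongrightarrow> D) sequentially"
    by (rule filterlim_compose)
  thus ?thesis
    by (rule bigoI_tendsto) (auto intro!: eventually_mono[OF eventually_gt_at_top[of 0]])
qed

lemma norm_of_nat_powr: "norm (of_nat r powr s :: complex) = real r powr Re s"
  using norm_powr_real_powr[of "of_nat r" s] by simp

text \<open>
  The shifted term \<open>f (r + 1)\<close> is expanded around \<open>r\<close> as well, by moving the shift into the
  quadratic and into \<open>a\<close>. Thus both terms carry the same factor \<open>r\<^bsup>2 - s\<^esup>\<close>, and subtracting them
  only requires subtracting two analytic functions with the same value at \<open>0\<close>.
\<close>
lemma H_term_one_eventually:
  shows "\<forall>\<^sub>F r in sequentially. H_term k 1 s a r = of_nat r powr (2 - s) *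
            H_germ (aug_alpha k) (aug_beta k) 1 a s (1 / of_nat r)" (is ?A)
   and "\<forall>\<^sub>F r in sequentially. H_term k 1 s a (Suc r) = of_nat r powr (2 - s) *
            H_germ (aug_alpha k) (2 * aug_alpha k + aug_beta k) (aug_alpha k + aug_beta k + 1)
              (a + 1) s (1 / of_nat r)" (is ?B)
proof -
  have ev: "\<forall>\<^sub>F r in sequentially. of_nat r + b \<noteq> 0" for b :: complex
  proof (rule eventually_mono[OF eventually_gt_at_top[of "nat \<lceil>norm b\<rceil>"]])
    fix r assume "r > nat \<lceil>norm b\<rceil>"
    hence "norm b < norm (of_nat r :: complex)" by simp linarith
    thus "of_nat r + b \<noteq> 0" by (metis add_eq_0_iff less_irrefl norm_minus_cancel)
  qed
  show ?A using ev[of a] eventually_gt_at_top[of 0]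
  proof eventually_elim
    case (elim r)
    have "H_term k 1 s a r = (of_real (aug_alpha k) * of_nat r ^ 2 + of_real (aug_beta k) * of_nat r + 1)
              / (of_nat r + a) powr s"
      unfolding H_term_def aug_tri_add_one by simp
    thus ?case using H_germ_expands[OF elim(2,1)] by simp
  qed
  show ?B using ev[of "a + 1"] eventually_gt_at_top[of 0]
  proof eventually_elim
    case (elim r)
    have "H_term k 1 s a (Suc r) = (of_real (aug_alpha k) * of_nat r ^ 2 + 
            (2 * of_real (aug_alpha k) + of_real (aug_beta k)) * of_nat r + 
            (of_real (aug_alpha k) + of_real (aug_beta k) + 1))
              / (of_nat r + (a + 1)) powr s"
      unfolding H_term_def aug_tri_add_one by (simp add: algebra_simps power2_eq_square)
    thus ?case using H_germ_expands[OF elim(2,1)] by simp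
  qed
qed

lemma norm_H_term_one_bigtheta:
  "(\<lambda>r. norm (H_term k 1 s a r)) \<in> \<Theta>(\<lambda>r. real r powr (2 - Re s))"
proof -
  let ?h = "H_germ (aug_alpha k) (aug_beta k) 1 a s"
  have "isCont ?h 0"
    using analytic_on_imp_differentiable_at[OF analytic_H_germ] field_differentiable_imp_continuous_at by blast
  hence lim: "(\<lambda>r. norm (?h (1 / of_nat r))) \<longlonglongrightarrow> norm (?h 0)"
    by (intro tendsto_norm isCont_tendsto_compose[of 0 ?h] lim_1_over_n)
  have "(\<lambda>r. norm (H_term k 1 s a r)) \<in> \<Theta>(\<lambda>r. real r powr (2 - Re s) * norm (?h (1 / of_nat r)))"
    by (intro bigthetaI_cong eventually_mono[OF H_term_one_eventually(1)[of k s a]])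
       (simp add: norm_mult norm_of_nat_powr)
  also have "(\<lambda>r. norm (?h (1 / of_nat r))) \<in> \<Theta>(\<lambda>r. 1)"
    using lim by (intro bigthetaI_tendsto[where c = "norm (?h 0)"]) (auto simp: aug_alpha_def)
  hence "(\<lambda>r. real r powr (2 - Re s) * norm (?h (1 / of_nat r))) \<in> \<Theta>(\<lambda>r. real r powr (2 - Re s) * 1)"
    by (intro landau_theta.mult bigtheta_refl)
  finally show ?thesis by simp
qed

lemma norm_H_term_one_diff_bigo:
  "(\<lambda>r. norm (H_term k 1 s a (Suc r) - H_term k 1 s a r)) \<in> O(\<lambda>r. real r powr (2 - Re s - 1))"
proof -
  define g where "g = (\<lambda>x. H_germ (aug_alpha k) (2 * aug_alpha k + aug_beta k)
      (aug_alpha k + aug_beta k + 1) (a + 1) s x - H_germ (aug_alpha k) (aug_beta k) 1 a s x)"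
  have "g analytic_on {0}" unfolding g_def by (intro analytic_on_diff analytic_H_germ)
  hence "(\<lambda>r. g (1 / of_nat r)) \<in> O(\<lambda>r. 1 / of_nat r)"
    by (rule analytic_bigo_at_inverse_nat) (simp add: g_def)
  hence "(\<lambda>r. norm (g (1 / of_nat r))) \<in> O(\<lambda>r. norm (1 / of_nat r :: complex))"
    by simp
  hence *: "(\<lambda>r. real r powr (2 - Re s) * norm (g (1 / of_nat r))) \<in> 
         O(\<lambda>r. real r powr (2 - Re s) * norm (1 / of_nat r :: complex))"
    by (rule landau_o.big.mult_left)
  have "(\<lambda>r. norm (H_term k 1 s a (Suc r) - H_term k 1 s a r)) \<in>
          \<Theta>(\<lambda>r. real r powr (2 - Re s) * norm (g (1 / of_nat r)))"
    using H_term_one_eventually[of k s a]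
    by (intro bigthetaI_cong, eventually_elim)
       (simp add: g_def norm_mult norm_of_nat_powr flip: right_diff_distrib)
  also note *
  also have "(\<lambda>r. real r powr (2 - Re s) * norm (1 / of_nat r :: complex)) \<in> \<Theta>(\<lambda>r. real r powr (2 - Re s - 1))"
    by (intro bigthetaI_cong eventually_mono[OF eventually_gt_at_top[of 0]])
       (simp add: powr_diff norm_divide power2_eq_square)
  finally show ?thesis .
qed

section \<open>Convergence in the closed unit disc\<close>

theorem theorem3p1:
  fixes k :: nat and a z s :: complex
  assumes "a \<notin> \<int>\<^sub>\<le>\<^sub>0"
  shows "(norm z < 1 \<longrightarrow> converges_absolutely (H_term k z s a)) \<and>
         (z = 1 \<longrightarrow>
           (summable (H_term k z s a) \<longleftrightarrow> Re s > 3) \<and>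
           (Re s > 3 \<longrightarrow> converges_absolutely (H_term k z s a))) \<and>
         (norm z = 1 \<and> z \<noteq> 1 \<longrightarrow>
           (summable (H_term k z s a) \<longleftrightarrow> Re s > 2) \<and>
           (Re s > 3 \<longrightarrow> converges_absolutely (H_term k z s a)) \<and>
           (2 < Re s \<and> Re s \<le> 3 \<longrightarrow> converges_conditionally (H_term k z s a)))"
proof -
  define f where "f = H_term k 1 s a"
  have H: "H_term k z s a = (\<lambda>r. f r * z ^ r)"
    by (simp add: f_def H_term_def fun_eq_iff)
  have f: "(\<lambda>r. norm (f r)) \<in> \<Theta>(\<lambda>r. real r powr (2 - Re s))"
    unfolding f_def by (rule norm_H_term_one_bigtheta)
  have df: "(\<lambda>r. norm (f (Suc r) - f r)) \<in> O(\<lambda>r. real r powr (2 - Re s - 1))"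
    unfolding f_def by (rule norm_H_term_one_diff_bigo)
  have fO: "(\<lambda>r. norm (f r)) \<in> O(\<lambda>r. real r powr (2 - Re s))"
    and fOm: "(\<lambda>r. norm (f r)) \<in> \<Omega>(\<lambda>r. real r powr (2 - Re s))"
    using f by (auto simp: bigtheta_def)
  have abs_iff: "converges_absolutely (H_term k z s a) \<longleftrightarrow> Re s > 3" if "norm z = 1"
    using summable_norm_iff_exponent[OF f] that
    by (auto simp: converges_absolutely_def H norm_mult norm_power)
  have inside: "converges_absolutely (H_term k z s a)" if "norm z < 1"
    using summable_norm_times_power[OF fO that] by (simp add: H converges_absolutely_def)
  have one: "Re s > 3" if "z = 1" "summable (H_term k z s a)"
  proof -
    have "summable f" using that by (simp add: f_def)
    from summable_imp_exponent_less_minus_one[OF fOm df this] show ?thesis by simp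
  qed
  have circle: "summable (H_term k z s a) \<longleftrightarrow> Re s > 2" if z: "norm z = 1" "z \<noteq> 1"
  proof
    assume "summable (H_term k z s a)"
    hence "(\<lambda>r. f r * z ^ r) \<longlonglongrightarrow> 0"
      unfolding H by (rule summable_LIMSEQ_zero)
    hence "f \<longlonglongrightarrow> 0"
      by (subst (asm) tendsto_norm_zero_iff [symmetric])
         (simp add: norm_mult norm_power z tendsto_norm_zero_iff)
    from tendsto_0_imp_exponent_neg[OF fOm this] show "Re s > 2" by simp
  next
    assume "Re s > 2"
    thus "summable (H_term k z s a)"
      unfolding H by (intro summable_times_power_unit_circle[OF fO df z]) simp
  qed
  have abs_imp: "summable (H_term k z s a)" if "converges_absolutely (H_term k z s a)"
    using that unfolding converges_absolutely_def by (rule summable_norm_cancel)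
  show ?thesis
    using abs_iff inside one circle abs_imp unfolding converges_conditionally_def by auto
qed

end
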